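(* (i) The distortion of the surface of a cone over the unit disc with sufficiently large height (e.g. $h=3$) is strictly smaller than $\pi/2$. (ii) The distortion of the boundary of a regular $(n+1)$-dimensional simplex is $\sqrt{2+2/n}$. In particular, for $n\geq 5$, the boundary of the regular $(n+1)$-simplex has a lower distortion than the round sphere.
   Context: For a path-connected subset $A\subset\mathbb{R}^n$, the intrinsic distance $d_A(p,q)$ of $p,q\in A$ is defined by minimising the length of paths in $A$ connecting $p$ and $q$. The distortion of $A$ is $\delta(A)=\sup_{p,q\in A}\frac{d_A(p,q)}{|p-q|}$ (over pairs $p\neq q$), where $|\cdot|$ is the Euclidean norm. Distortion is invariant under isometries and scalings of $\mathbb{R}^n$. In (i), the surface of the cone of height $h>0$ over the unit disc is the topologically embedded 2-sphere in $\mathbb{R}^3$ consisting of the closed unit disc $\{(x,y,h): x^2+y^2\le 1\}$ (the base) together with the lateral surface $\{(x,y,z): x^2+y^2=z^2/h^2,\ 0\le z\le h\}$. In (ii), $n\ge 1$ is an integer, the regular $(n+1)$-simplex may be taken to be $S=\{x\in\mathbb{R}^{n+2}: x_1+\dots+x_{n+2}=1,\ x_1,\dots,x_{n+2}\ge 0\}$, and its boundary is $\{x\in S: x_i=0 \text{ for some } i\}$. The round sphere is the standard $n$-sphere in $\mathbb{R}^{n+1}$.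
   Formalization: The example "e.g. h=3" in (i) is omitted because it is false: for h=3 the points (0.7,0,3) and (0.9,0,2.7) already give a ratio above 1.70 > π/2; only "for all sufficiently large heights" is stated, with no explicit height. *)

theory Defs
  imports "HOL-Analysis.Analysis"
begin

text \<open>
  Lengths, intrinsic distances and distortions take values in \<^typ>\<open>ennreal\<close>: a continuous path
  need not be rectifiable, in which case its length is \<^term>\<open>top\<close>.
\<close>

definition path_length :: "(real \<Rightarrow> 'a::metric_space) \<Rightarrow> ennreal" where
  "path_length g =
     (SUP (m, t) \<in> {(m :: nat, t :: nat \<Rightarrow> real). mono_on {..m} t \<and> t ` {..m} \<subseteq> {0..1}}.
        ennreal (\<Sum>i<m. dist (g (t i)) (g (t (Suc i)))))"

definition intrinsic_dist :: "'a::metric_space set \<Rightarrow> 'a \<Rightarrow> 'a \<Rightarrow> ennreal" where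
  "intrinsic_dist A p q =
     (INF g \<in> {g. path g \<and> path_image g \<subseteq> A \<and> pathstart g = p \<and> pathfinish g = q}. path_length g)"

definition distortion :: "'a::metric_space set \<Rightarrow> ennreal" where
  "distortion A =
     (SUP (p, q) \<in> {(p, q). p \<in> A \<and> q \<in> A \<and> p \<noteq> q}. intrinsic_dist A p q / ennreal (dist p q))"

text \<open>The apex of the cone is the origin; the base is the closed unit disc at height \<^term>\<open>h\<close>.
  Base and lateral surface meet at the angle \<^term>\<open>arctan h\<close>, so the distortion is at least
  \<^term>\<open>1 / sin (arctan h / 2)\<close>. This exceeds \<^term>\<open>pi / 2\<close> at \<^term>\<open>h = 3\<close>, and drops below it
  only for \<^term>\<open>h\<close> larger than about 5.2.\<close>

definition cone_base :: "real \<Rightarrow> (real^3) set" where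
  "cone_base h = {v. (v$1)\<^sup>2 + (v$2)\<^sup>2 \<le> 1 \<and> v$3 = h}"

definition cone_lateral :: "real \<Rightarrow> (real^3) set" where
  "cone_lateral h = {v. (v$1)\<^sup>2 + (v$2)\<^sup>2 = (v$3)\<^sup>2 / h\<^sup>2 \<and> 0 \<le> v$3 \<and> v$3 \<le> h}"

definition cone_surface :: "real \<Rightarrow> (real^3) set" where
  "cone_surface h = cone_base h \<union> cone_lateral h"

text \<open>
  The regular simplex is the standard one, of dimension \<^term>\<open>CARD('n) - 1\<close>; so the boundary of the
  regular $(n+1)$-simplex is obtained with \<^term>\<open>CARD('n) = n + 2\<close>.
\<close>

definition regular_simplex :: "(real^'n) set" where
  "regular_simplex = {x. (\<Sum>i\<in>UNIV. x$i) = 1 \<and> (\<forall>i. 0 \<le> x$i)}"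

definition simplex_boundary :: "(real^'n) set" where
  "simplex_boundary = {x \<in> regular_simplex. \<exists>i. x$i = 0}"

end

theory Submission
  imports Defs "HOL-Real_Asymp.Real_Asymp"
begin

text \<open>
  Every upper bound comes from an explicit path of at most two pieces, and every lower bound from
  intermediate points that a continuous path cannot avoid.

  \<^bold>\<open>Cone.\<close> For two points of the lateral surface, unroll it: with \<open>k\<close> the sine of the half
  opening angle, a difference \<open>\<phi> \<le> \<pi>\<close> of angles around the axis becomes the planar angle
  \<open>k \<phi>\<close>. Comparing the two laws of cosines, the ratio of distances is at most
  \<open>sin (k \<phi> / 2) / (k sin (\<phi> / 2))\<close> wherever this exceeds \<open>1\<close>. It is largest for opposite points,
  \<open>\<phi> = \<pi>\<close>, where its value \<open>sin (k \<pi> / 2) / k\<close> is below \<open>\<pi> / 2\<close>, though only by an amount that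
  tends to \<open>0\<close> with growing height (\<open>dist_cis_le_dist_cone_point\<close>). For a lateral point and a base
  point, go along the generator to the rim and then straight across the base. On a tall cone base and
  lateral surface are nearly orthogonal, so this costs a factor near \<open>\<surd>2\<close>, safely below \<open>\<pi> / 2\<close>
  (\<open>cone_base_lateral_route\<close>).

  \<^bold>\<open>Simplex.\<close> Two points in different facets are joined by unfolding the facets around their
  common ridge. The unfolded segment always crosses the hinge inside the ridge, because its crossing
  point has nonnegative barycentric coordinates; so only its length has to be compared with the
  straight distance (\<open>power2_dist_folding_point\<close>, \<open>folded_length_le\<close>). Equality occurs for two points
  placed symmetrically near the centre of a ridge: a path between them either meets the ridge, which
  costs exactly the bound, or leaves the two facets and is longer still
  (\<open>distortion_simplex_boundary_ge\<close>).

  \<^bold>\<open>Sphere.\<close> A path between antipodal points has length at least \<open>\<pi>\<close>, because the angle to the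
  starting point sweeps through \<open>[0, \<pi>]\<close> and a chord is no shorter than the chord of the angle
  difference (\<open>sphere_path_length_ge\<close>). Hence the sphere has distortion at least \<open>\<pi> / 2\<close>, which
  exceeds \<open>\<surd>(2 + 2 / n) \<le> \<surd>(12 / 5)\<close> for \<open>n \<ge> 5\<close>.
\<close>

section \<open>Lengths of paths and intrinsic distances\<close>

lemma path_length_le_lipschitz:
  assumes "L-lipschitz_on {0..1} g"
  shows "path_length g \<le> ennreal L"
proof -
  have "(\<Sum>i<m. dist (g (t i)) (g (t (Suc i)))) \<le> L"
    if t: "mono_on {..m} t" "t ` {..m} \<subseteq> {0..1}" for m :: nat and t :: "nat \<Rightarrow> real"
  proof -
    have L: "0 \<le> L" using assms by (rule lipschitz_on_nonneg)
    have "(\<Sum>i<m. dist (g (t i)) (g (t (Suc i)))) \<le> (\<Sum>i<m. L * (t (Suc i) - t i))"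
    proof (rule sum_mono)
      fix i assume "i \<in> {..<m}"
      then have i: "i \<le> m" "Suc i \<le> m" by auto
      have "t i \<le> t (Suc i)" using t(1) i by (auto simp: mono_on_def)
      moreover have "t i \<in> {0..1}" "t (Suc i) \<in> {0..1}" using t(2) i by blast+
      ultimately show "dist (g (t i)) (g (t (Suc i))) \<le> L * (t (Suc i) - t i)"
        using lipschitz_onD[OF assms, of "t i" "t (Suc i)"] by (auto simp: dist_real_def)
    qed
    also have "\<dots> = L * (t m - t 0)"
      by (simp add: sum_distrib_left[symmetric] sum_lessThan_telescope)
    also have "\<dots> \<le> L * 1"
    proof (rule mult_left_mono[OF _ L])
      have "t m \<in> {0..1}" "t 0 \<in> {0..1}" using t(2) by blast+
      then show "t m - t 0 \<le> 1" by auto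
    qed
    finally show ?thesis by simp
  qed
  then show ?thesis
    unfolding path_length_def by (auto intro!: SUP_least ennreal_leI)
qed

lemma path_length_ge_sum:
  assumes "mono_on {..m} t" "t ` {..m} \<subseteq> {0..1}"
  shows "ennreal (\<Sum>i<m. dist (g (t i)) (g (t (Suc i)))) \<le> path_length g"
  unfolding path_length_def
  by (rule SUP_upper2[where i = "(m, t)"]) (use assms in auto)

lemma path_length_ge_via:
  assumes "t \<in> {0..1}"
  shows "ennreal (dist (pathstart g) (g t) + dist (g t) (pathfinish g)) \<le> path_length g"
proof -
  define u where "u = (\<lambda>i::nat. if i = 0 then 0 else if i = 1 then t else 1 :: real)"
  have "mono_on {..2} u" "u ` {..2} \<subseteq> {0..1}"
    using assms by (auto simp: u_def mono_on_def)
  from path_length_ge_sum[OF this, of g] show ?thesis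
    by (simp add: u_def pathstart_def pathfinish_def numeral_2_eq_2)
qed

text \<open>
  Cutting every partition at the junction time \<open>1 / 2\<close> does not shorten the polygon. Clamping the
  partition points to either half of the unit interval, by minimum and maximum, performs the cut
  without locating the interval that contains \<open>1 / 2\<close>.
\<close>

lemma path_length_join_le:
  assumes "pathfinish g1 = pathstart g2"
  shows "path_length (g1 +++ g2) \<le> path_length g1 + path_length g2"
  unfolding path_length_def[of "g1 +++ g2"]
proof (rule SUP_least, clarify)
  fix m :: nat and t :: "nat \<Rightarrow> real"
  assume mono: "mono_on {..m} t" and rng: "t ` {..m} \<subseteq> {0..1}"
  define u where "u = (\<lambda>i. 2 * min (t i) (1/2))"
  define v where "v = (\<lambda>i. 2 * max (t i) (1/2) - 1)"
  have tm: "t i \<le> t j" if "i \<le> j" "j \<le> m" for i j using mono that by (auto simp: mono_on_def)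
  have tr: "0 \<le> t i" "t i \<le> 1" if "i \<le> m" for i using rng that by auto
  have u: "mono_on {..m} u" "u ` {..m} \<subseteq> {0..1}"
    by (auto simp: u_def mono_on_def min_def dest: tm tr intro: tr)
  have v: "mono_on {..m} v" "v ` {..m} \<subseteq> {0..1}"
    by (auto simp: v_def mono_on_def max_def dest: tm tr intro: tr)
  have split: "dist ((g1 +++ g2) a) ((g1 +++ g2) b)
      \<le> dist (g1 (2 * min a (1/2))) (g1 (2 * min b (1/2)))
        + dist (g2 (2 * max a (1/2) - 1)) (g2 (2 * max b (1/2) - 1))" if "a \<le> b" for a b
    using that assms dist_triangle[of "g1 (2 * a)" "g2 (2 * b - 1)" "g1 1"]
    by (auto simp: joinpaths_def pathstart_def pathfinish_def min_def max_def)
  have "(\<Sum>i<m. dist ((g1 +++ g2) (t i)) ((g1 +++ g2) (t (Suc i))))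
      \<le> (\<Sum>i<m. dist (g1 (u i)) (g1 (u (Suc i))) + dist (g2 (v i)) (g2 (v (Suc i))))"
    unfolding u_def v_def by (intro sum_mono split tm) auto
  then have "ennreal (\<Sum>i<m. dist ((g1 +++ g2) (t i)) ((g1 +++ g2) (t (Suc i))))
      \<le> ennreal (\<Sum>i<m. dist (g1 (u i)) (g1 (u (Suc i))))
        + ennreal (\<Sum>i<m. dist (g2 (v i)) (g2 (v (Suc i))))"
    by (simp add: sum.distrib ennreal_leI sum_nonneg flip: ennreal_plus)
  also have "\<dots> \<le> path_length g1 + path_length g2"
    by (intro add_mono path_length_ge_sum u v)
  finally show "ennreal (\<Sum>i<m. dist ((g1 +++ g2) (t i)) ((g1 +++ g2) (t (Suc i))))
      \<le> path_length g1 + path_length g2" .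
qed

lemma path_length_linepath_le: "path_length (linepath p q) \<le> ennreal (dist p q)"
proof (rule path_length_le_lipschitz, rule lipschitz_onI)
  fix x y :: real
  have "linepath p q x - linepath p q y = (x - y) *\<^sub>R (q - p)"
    by (simp add: linepath_def algebra_simps)
  then show "dist (linepath p q x) (linepath p q y) \<le> dist p q * dist x y"
    by (simp add: dist_norm norm_minus_commute)
qed simp

lemma intrinsic_dist_le:
  assumes "path g" "path_image g \<subseteq> A" "pathstart g = p" "pathfinish g = q" "path_length g \<le> L"
  shows "intrinsic_dist A p q \<le> L"
  unfolding intrinsic_dist_def by (rule INF_lower2[of g]) (use assms in auto)

lemma intrinsic_dist_ge:
  assumes "\<And>g. \<lbrakk>path g; path_image g \<subseteq> A; pathstart g = p; pathfinish g = q\<rbrakk> \<Longrightarrow> L \<le> path_length g"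
  shows "L \<le> intrinsic_dist A p q"
  unfolding intrinsic_dist_def by (rule INF_greatest) (use assms in auto)

lemma intrinsic_dist_le_segment:
  fixes p q :: "'a::real_normed_vector"
  assumes "closed_segment p q \<subseteq> A"
  shows "intrinsic_dist A p q \<le> ennreal (dist p q)"
  by (rule intrinsic_dist_le[of "linepath p q"]) (use assms path_length_linepath_le in auto)

lemma intrinsic_dist_le_via:
  fixes p q r :: "'a::real_normed_vector"
  assumes "closed_segment p r \<subseteq> A" "closed_segment r q \<subseteq> A"
  shows "intrinsic_dist A p q \<le> ennreal (dist p r + dist r q)"
proof (rule intrinsic_dist_le[of "linepath p r +++ linepath r q"])
  have "path_length (linepath p r +++ linepath r q)
      \<le> path_length (linepath p r) + path_length (linepath r q)"
    by (rule path_length_join_le) simp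
  also have "\<dots> \<le> ennreal (dist p r) + ennreal (dist r q)"
    by (intro add_mono path_length_linepath_le)
  finally show "path_length (linepath p r +++ linepath r q) \<le> ennreal (dist p r + dist r q)"
    by simp
qed (use assms in \<open>auto simp: path_image_join\<close>)

lemma distortion_le:
  assumes "0 \<le> C"
    and "\<And>p q. \<lbrakk>p \<in> A; q \<in> A; p \<noteq> q\<rbrakk> \<Longrightarrow> intrinsic_dist A p q \<le> ennreal (C * dist p q)"
  shows "distortion A \<le> ennreal C"
  unfolding distortion_def
proof (rule SUP_least, clarify)
  fix p q assume pq: "p \<in> A" "q \<in> A" "p \<noteq> q"
  have "intrinsic_dist A p q / ennreal (dist p q) \<le> ennreal (C * dist p q) / ennreal (dist p q)"
    by (intro divide_right_mono_ennreal assms pq)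
  also have "\<dots> = ennreal C" using pq assms(1) by (simp add: divide_ennreal)
  finally show "intrinsic_dist A p q / ennreal (dist p q) \<le> ennreal C" .
qed

lemma distortion_ge:
  assumes "0 \<le> C" "p \<in> A" "q \<in> A" "p \<noteq> q" "ennreal (C * dist p q) \<le> intrinsic_dist A p q"
  shows "ennreal C \<le> distortion A"
proof -
  have "ennreal C = ennreal (C * dist p q) / ennreal (dist p q)"
    using assms by (simp add: divide_ennreal)
  also have "\<dots> \<le> intrinsic_dist A p q / ennreal (dist p q)"
    by (intro divide_right_mono_ennreal assms)
  also have "\<dots> \<le> distortion A"
    unfolding distortion_def by (rule SUP_upper2[where i = "(p, q)"]) (use assms in auto)
  finally show ?thesis .
qed

section \<open>The round sphere\<close>

text \<open>
  The triangle inequality for angles on the unit sphere, by the spherical law of cosines: split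
  \<open>x\<close> and \<open>y\<close> into components along \<open>p\<close> and orthogonal to it. The orthogonal parts have
  the sines of the two angles as norms, and Cauchy-Schwarz bounds their inner product.
\<close>

lemma inner_le_cos_arccos_diff:
  fixes x y p :: "'a::real_inner"
  assumes "norm x = 1" "norm y = 1" "norm p = 1"
  shows "x \<bullet> y \<le> cos (arccos (x \<bullet> p) - arccos (y \<bullet> p))"
proof -
  have le1: "\<bar>z \<bullet> p\<bar> \<le> 1" if "norm z = 1" for z
    using Cauchy_Schwarz_ineq2[of z p] that assms by simp
  have perp: "norm (z - (z \<bullet> p) *\<^sub>R p) = sin (arccos (z \<bullet> p))" if z: "norm z = 1" for z
  proof -
    have "z \<bullet> z = 1" "p \<bullet> p = 1" using z assms by (simp_all add: dot_square_norm)
    then have "(z - (z \<bullet> p) *\<^sub>R p) \<bullet> (z - (z \<bullet> p) *\<^sub>R p) = 1 - (z \<bullet> p)\<^sup>2"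
      by (simp add: inner_diff_left inner_diff_right inner_commute power2_eq_square)
    then show ?thesis using le1[OF z] by (simp add: norm_eq_sqrt_inner sin_arccos_abs)
  qed
  have "p \<bullet> p = 1" using assms by (simp add: dot_square_norm)
  then have "x \<bullet> y - (x \<bullet> p) * (y \<bullet> p) = (x - (x \<bullet> p) *\<^sub>R p) \<bullet> (y - (y \<bullet> p) *\<^sub>R p)"
    by (simp add: inner_diff_left inner_diff_right inner_commute)
  also have "\<dots> \<le> sin (arccos (x \<bullet> p)) * sin (arccos (y \<bullet> p))"
    unfolding perp[OF assms(1), symmetric] perp[OF assms(2), symmetric]
    by (rule norm_cauchy_schwarz)
  finally show ?thesis using le1[OF assms(1)] le1[OF assms(2)] by (simp add: cos_diff)
qed

lemma dist_ge_chord: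
  fixes x y p :: "'a::real_inner"
  assumes "norm x = 1" "norm y = 1" "norm p = 1"
  shows "2 * sin ((arccos (y \<bullet> p) - arccos (x \<bullet> p)) / 2) \<le> dist x y"
proof -
  define d where "d = arccos (y \<bullet> p) - arccos (x \<bullet> p)"
  have "(2 * sin (d / 2))\<^sup>2 = 2 - 2 * cos d"
    using cos_double_sin[of "d / 2"] by (simp add: power_mult_distrib)
  also have "\<dots> \<le> 2 - 2 * (x \<bullet> y)"
    using inner_le_cos_arccos_diff[of y x p] assms by (simp add: d_def inner_commute)
  also have "\<dots> = (dist x y)\<^sup>2"
    using assms by (simp add: dist_norm power2_norm_eq_inner inner_diff_left inner_diff_right
        inner_commute) (simp add: dot_square_norm)
  finally show ?thesis
    unfolding d_def using power2_le_imp_le zero_le_dist by blast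
qed

text \<open>
  The angle \<open>\<theta>\<close> to \<open>p\<close> runs continuously from \<open>0\<close> to \<open>\<pi>\<close>. It need not be monotone, but
  successive uses of the intermediate value theorem give increasing times at which it takes the
  equally spaced values \<open>i \<pi> / m\<close>. The inscribed polygon has length at least that of half a regular
  \<open>2m\<close>-gon.
\<close>

lemma sphere_path_length_ge:
  fixes p :: "'a::real_inner"
  assumes p: "norm p = 1"
    and g: "path g" "path_image g \<subseteq> sphere 0 1" "pathstart g = p" "pathfinish g = - p"
  shows "ennreal pi \<le> path_length g"
proof -
  define \<theta> where "\<theta> = (\<lambda>t. arccos (g t \<bullet> p))"
  have pp: "p \<bullet> p = 1" using p by (simp add: dot_square_norm)
  have ng: "norm (g t) = 1" if "t \<in> {0..1}" for t
    using g(2) imageI[OF that, of g] by (force simp: path_image_def)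
  have le1: "\<forall>t\<in>{0..1}. - 1 \<le> g t \<bullet> p \<and> g t \<bullet> p \<le> 1"
  proof
    fix t :: real assume "t \<in> {0..1}"
    then show "- 1 \<le> g t \<bullet> p \<and> g t \<bullet> p \<le> 1"
      using Cauchy_Schwarz_ineq2[of "g t" p] ng p by auto
  qed
  have cont: "continuous_on {0..1} \<theta>"
    unfolding \<theta>_def using g(1) le1
    by (intro continuous_intros) (auto simp: path_def)
  have ends: "\<theta> 0 = 0" "\<theta> 1 = pi"
    using g(3,4) pp by (auto simp: \<theta>_def pathstart_def pathfinish_def)
  have steps: "ennreal (2 * real m * sin (pi / (2 * real m))) \<le> path_length g" if m: "m > 0" for m
  proof -
    \<comment> \<open>The minimum makes the levels constant from index \<open>m\<close> on, so that infinitely many times can be chosen.\<close>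
    define lev where "lev = (\<lambda>i. real (min i m) * pi / real m)"
    have lev_le: "lev i \<le> pi" for i using m by (simp add: lev_def field_simps min_def)
    have lev_mono: "lev i \<le> lev (Suc i)" for i
      unfolding lev_def using m by (intro divide_right_mono mult_right_mono) auto
    obtain t where t: "\<And>i. t i \<in> {0..1} \<and> \<theta> (t i) = lev i" "\<And>i. t i \<le> t (Suc i)"
    proof -
      have "\<exists>f. \<forall>i. (f i \<in> {0..1} \<and> \<theta> (f i) = lev i) \<and> f i \<le> f (Suc i)"
      proof (rule dependent_nat_choice)
        show "\<exists>x. x \<in> {0..1} \<and> \<theta> x = lev 0"
          by (rule exI[of _ 0]) (simp add: lev_def ends)
      next
        fix x i assume x: "x \<in> {0..1} \<and> \<theta> x = lev i"
        have "\<exists>y\<ge>x. y \<le> 1 \<and> \<theta> y = lev (Suc i)"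
          by (rule IVT') (use x lev_mono[of i] lev_le[of "Suc i"] ends in
              \<open>auto intro: continuous_on_subset[OF cont]\<close>)
        then obtain y where "x \<le> y" "y \<le> 1" "\<theta> y = lev (Suc i)" by blast
        then show "\<exists>y. (y \<in> {0..1} \<and> \<theta> y = lev (Suc i)) \<and> x \<le> y"
          by (intro exI[of _ y]) (use x in auto)
      qed
      then show ?thesis using that by blast
    qed
    have "mono t" using t(2) by (simp add: mono_iff_le_Suc)
    then have mono: "mono_on {..m} t" by (auto simp: mono_on_def mono_def)
    have "2 * real m * sin (pi / (2 * real m)) = (\<Sum>i<m. 2 * sin (pi / real m / 2))"
      by (simp add: mult.commute)
    also have "\<dots> \<le> (\<Sum>i<m. dist (g (t i)) (g (t (Suc i))))"
    proof (rule sum_mono)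
      fix i assume i: "i \<in> {..<m}"
      have "\<theta> (t (Suc i)) - \<theta> (t i) = pi / real m"
        using t(1)[of i] t(1)[of "Suc i"] i m by (simp add: lev_def field_simps)
      then show "2 * sin (pi / real m / 2) \<le> dist (g (t i)) (g (t (Suc i)))"
        using dist_ge_chord[of "g (t i)" "g (t (Suc i))" p] ng[of "t i"] ng[of "t (Suc i)"] t(1) p
        by (simp add: \<theta>_def)
    qed
    finally show ?thesis
      using path_length_ge_sum[OF mono, of g] t(1) by (meson ennreal_leI image_subsetI order_trans)
  qed
  have "(\<lambda>m. 2 * real m * sin (pi / (2 * real m))) \<longlonglongrightarrow> pi" by real_asymp
  then have "(\<lambda>m. ennreal (2 * real m * sin (pi / (2 * real m)))) \<longlonglongrightarrow> ennreal pi"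
    by (rule tendsto_ennrealI)
  then show ?thesis
    by (rule LIMSEQ_le_const2) (use steps in \<open>auto intro: exI[of _ 1]\<close>)
qed

lemma distortion_sphere_ge:
  "ennreal (pi / 2) \<le> distortion (sphere (0 :: real^'m::finite) 1)"
proof -
  obtain p :: "real^'m" where p: "norm p = 1" using vector_choose_size[of 1] by auto
  have d: "dist p (- p) = 2" using p by (simp add: dist_norm flip: scaleR_2)
  show ?thesis
  proof (rule distortion_ge[of _ p _ "- p"])
    show "ennreal (pi / 2 * dist p (- p)) \<le> intrinsic_dist (sphere 0 1) p (- p)"
      unfolding d by (rule intrinsic_dist_ge) (use sphere_path_length_ge[OF p] in auto)
    show "p \<noteq> - p" using d by (metis dist_self zero_neq_numeral)
  qed (use p in auto)
qed

section \<open>The boundary of the regular simplex\<close>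

lemma sum_UNIV_split_two:
  fixes f :: "'n::finite \<Rightarrow> real"
  assumes "i \<noteq> j"
  shows "sum f UNIV = f i + f j + sum f (UNIV - {i, j})"
  using sum.subset_diff[of "{i, j}" UNIV f] assms by simp

lemma power2_dist_vec: "(dist x y)\<^sup>2 = (\<Sum>i\<in>UNIV. (x $ i - y $ i)\<^sup>2)" for x y :: "real^'n::finite"
  unfolding dist_norm power2_norm_eq_inner by (simp add: inner_vec_def power2_eq_square)

lemma power2_dist_vec_split_two:
  fixes x y :: "real^'n::finite"
  assumes "i \<noteq> j"
  shows "(dist x y)\<^sup>2
    = (x $ i - y $ i)\<^sup>2 + (x $ j - y $ j)\<^sup>2 + (\<Sum>k\<in>UNIV - {i, j}. (x $ k - y $ k)\<^sup>2)"
  unfolding power2_dist_vec by (rule sum_UNIV_split_two[OF assms])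

lemma convex_regular_simplex_facet: "convex {x \<in> regular_simplex :: (real^'n::finite) set. x $ i = 0}"
proof (rule convexI)
  fix x y :: "real^'n" and u v :: real
  assume "x \<in> {x \<in> regular_simplex. x $ i = 0}" "y \<in> {x \<in> regular_simplex. x $ i = 0}"
    "0 \<le> u" "0 \<le> v" "u + v = 1"
  then show "u *\<^sub>R x + v *\<^sub>R y \<in> {x \<in> regular_simplex. x $ i = 0}"
    by (simp add: regular_simplex_def sum.distrib flip: sum_distrib_left)
qed

text \<open>
  Each facet is convex, so its points are joined by straight segments.
\<close>

lemma closed_segment_subset_simplex_boundary:
  assumes "x \<in> regular_simplex" "y \<in> regular_simplex" "x $ i = 0" "y $ i = 0"
  shows "closed_segment x y \<subseteq> (simplex_boundary :: (real^'n::finite) set)"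
proof -
  have "closed_segment x y \<subseteq> {x \<in> regular_simplex. x $ i = 0}"
    by (rule closed_segment_subset[OF _ _ convex_regular_simplex_facet]) (use assms in auto)
  then show ?thesis by (auto simp: simplex_boundary_def)
qed

text \<open>
  Write \<open>a\<close> for \<open>p $ j\<close> and \<open>b\<close> for \<open>q $ i\<close>. Turning the facet of \<open>p\<close> about the ridge
  \<open>x $ i = x $ j = 0\<close> into the hyperplane of the other facet moves vertex \<open>j\<close> to the mirror image
  of vertex \<open>i\<close> in the ridge, that is, to twice the centre of the ridge minus vertex \<open>i\<close>. The point
  \<open>p\<close> then has coordinate \<open>-a\<close> at \<open>i\<close> and \<open>p $ k + 2 a / n\<close> at the other \<open>k\<close>. The segment from
  there to \<open>q\<close> crosses the ridge in \<open>r\<close>, at the fraction \<open>a / (a + b)\<close> of its length, whose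
  square is the last factor. That length is symmetric in the two points, so the same formula gives
  the distance from \<open>q\<close> to \<open>r\<close>.
\<close>

lemma power2_dist_folding_point:
  fixes p q r :: "real^'n::finite" and n :: nat and i j :: 'n
  defines "K \<equiv> UNIV - {i, j} :: 'n set"
  assumes n: "n \<ge> 1" "CARD('n) = n + 2"
    and p: "p \<in> regular_simplex" "p $ i = 0" and q: "q \<in> regular_simplex" "q $ j = 0"
    and ij: "i \<noteq> j" and pos: "0 < p $ j" "0 < q $ i"
    and r: "r $ i = 0" "r $ j = 0" "\<And>k. k \<in> K \<Longrightarrow>
      r $ k = (q $ i * p $ k + p $ j * q $ k + 2 * p $ j * q $ i / n) / (p $ j + q $ i)"
  shows "(dist p r)\<^sup>2 = (p $ j / (p $ j + q $ i))\<^sup>2 *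
     ((p $ j + q $ i)\<^sup>2 + (\<Sum>k\<in>K. (p $ k - q $ k)\<^sup>2) + 4 * p $ j * q $ i / n)"
proof -
  define a b where "a = p $ j" and "b = q $ i"
  define D where "D = (\<Sum>k\<in>K. (p $ k - q $ k)\<^sup>2)"
  have ab: "0 < a + b" using pos by (simp add: a_def b_def)
  have card: "card (K) = n" using n ij by (simp add: K_def card_Diff_subset)
  have "(\<Sum>k\<in>UNIV. p $ k) = 1" "(\<Sum>k\<in>UNIV. q $ k) = 1"
    using p q by (auto simp: regular_simplex_def)
  then have sum_diff: "(\<Sum>k\<in>K. p $ k - q $ k) = b - a"
    using sum_UNIV_split_two[OF ij, of "($) p"] sum_UNIV_split_two[OF ij, of "($) q"] p q
    by (simp add: K_def a_def b_def sum_subtractf)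
  have sq_diff: "(p $ k - r $ k)\<^sup>2
      = (a / (a + b))\<^sup>2 * ((p $ k - q $ k)\<^sup>2 - 4 * b / n * (p $ k - q $ k) + 4 * b\<^sup>2 / n\<^sup>2)"
    if "k \<in> K" for k
  proof -
    have "p $ k - r $ k = ((a + b) * p $ k - (b * p $ k + a * q $ k + 2 * a * b / n)) / (a + b)"
      using ab unfolding r(3)[OF that] a_def[symmetric] b_def[symmetric]
      by (simp add: diff_divide_distrib)
    also have "(a + b) * p $ k - (b * p $ k + a * q $ k + 2 * a * b / n)
        = a * (p $ k - q $ k - 2 * b / n)"
      by (simp add: algebra_simps)
    finally have diff: "p $ k - r $ k = a / (a + b) * (p $ k - q $ k - 2 * b / n)" by simp
    have "(x - 2 * b / n)\<^sup>2 = x\<^sup>2 - 4 * b / n * x + 4 * b\<^sup>2 / n\<^sup>2" for x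
      by (simp add: power2_diff power_divide power_mult_distrib)
    then show ?thesis unfolding diff power_mult_distrib by simp
  qed
  have "(dist p r)\<^sup>2 = a\<^sup>2 + (\<Sum>k\<in>K. (p $ k - r $ k)\<^sup>2)"
    using power2_dist_vec_split_two[OF ij, of p r] p r by (simp add: K_def a_def)
  also have "\<dots> = a\<^sup>2 + (a / (a + b))\<^sup>2 * (D - 4 * b / n * (b - a) + n * (4 * b\<^sup>2 / n\<^sup>2))"
  proof -
    define e where "e = (\<lambda>k. p $ k - q $ k)"
    have "(\<Sum>k\<in>K. (p $ k - r $ k)\<^sup>2)
        = (\<Sum>k\<in>K. (a / (a + b))\<^sup>2 * ((e k)\<^sup>2 - 4 * b / n * e k + 4 * b\<^sup>2 / n\<^sup>2))"
      using sq_diff unfolding e_def by (rule sum.cong[OF refl])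
    also have "\<dots> = (a / (a + b))\<^sup>2
        * ((\<Sum>k\<in>K. (e k)\<^sup>2) - 4 * b / n * sum e (K) + n * (4 * b\<^sup>2 / n\<^sup>2))"
      by (simp only: sum.distrib sum_subtractf sum_distrib_left[symmetric] sum_constant card)
    finally show ?thesis using sum_diff by (simp add: D_def e_def)
  qed
  also have "\<dots> = (a / (a + b))\<^sup>2 * ((a + b)\<^sup>2 + D + 4 * a * b / n)"
  proof -
    have a2: "a\<^sup>2 = (a / (a + b))\<^sup>2 * (a + b)\<^sup>2" using ab by (simp add: power_divide)
    have mid: "D - 4 * b / n * (b - a) + n * (4 * b\<^sup>2 / n\<^sup>2) = D + 4 * a * b / n"
      using n by (simp add: field_simps power2_eq_square)
    show ?thesis by (simp only: mid distrib_left a2[symmetric] add.assoc)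
  qed
  finally show ?thesis by (simp add: a_def b_def D_def)
qed

text \<open>
  The slack is a nonnegative combination of \<open>(a - b)\<^sup>2\<close> and the squared distance in the ridge
  coordinates, where \<open>a\<close> and \<open>b\<close> are \<open>p $ j\<close> and \<open>q $ i\<close>. It vanishes exactly when the two points
  are mirror images, which is how the extremal pair is found.
\<close>

lemma folded_length_le:
  fixes p q :: "real^'n::finite" and n :: nat and i j :: 'n
  defines "K \<equiv> UNIV - {i, j} :: 'n set"
  assumes n: "n \<ge> 1" and ij: "i \<noteq> j" and zero: "p $ i = 0" "q $ j = 0"
  shows "(p $ j + q $ i)\<^sup>2 + (\<Sum>k\<in>K. (p $ k - q $ k)\<^sup>2) + 4 * p $ j * q $ i / n
    \<le> (2 + 2 / n) * (dist p q)\<^sup>2"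
proof -
  define a b where "a = p $ j" and "b = q $ i"
  define D where "D = (\<Sum>k\<in>K. (p $ k - q $ k)\<^sup>2)"
  have "0 \<le> D" unfolding D_def by (intro sum_nonneg) auto
  then have "0 \<le> (a - b)\<^sup>2 + 2 / n * (a - b)\<^sup>2 + (1 + 2 / n) * D" by simp
  also have "\<dots> = (2 + 2 / n) * (b\<^sup>2 + a\<^sup>2 + D) - ((a + b)\<^sup>2 + D + 4 * a * b / n)"
    using n by (simp add: field_simps power2_eq_square)
  also have "b\<^sup>2 + a\<^sup>2 + D = (dist p q)\<^sup>2"
    using power2_dist_vec_split_two[OF ij, of p q] zero by (simp add: K_def a_def b_def D_def)
  finally show ?thesis by (simp add: a_def b_def D_def)
qed

lemma intrinsic_dist_simplex_boundary_le:
  fixes p q :: "real^'n::finite" and n :: nat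
  assumes n: "n \<ge> 1" "CARD('n) = n + 2" and pq: "p \<in> simplex_boundary" "q \<in> simplex_boundary"
  shows "intrinsic_dist simplex_boundary p q \<le> ennreal (sqrt (2 + 2 / n) * dist p q)"
proof -
  obtain i j where p: "p \<in> regular_simplex" "p $ i = 0" and q: "q \<in> regular_simplex" "q $ j = 0"
    using pq by (auto simp: simplex_boundary_def)
  show ?thesis
  proof (cases "p $ j = 0 \<or> q $ i = 0")
    case True
    have "closed_segment p q \<subseteq> simplex_boundary"
      using True closed_segment_subset_simplex_boundary[OF p(1) q(1)] p q by blast
    then have "intrinsic_dist simplex_boundary p q \<le> ennreal (dist p q)"
      by (rule intrinsic_dist_le_segment)
    also have "1 * dist p q \<le> sqrt (2 + 2 / n) * dist p q"
      by (intro mult_right_mono) auto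
    then have "ennreal (dist p q) \<le> ennreal (sqrt (2 + 2 / n) * dist p q)"
      by (simp add: ennreal_leI)
    finally show ?thesis .
  next
    case False
    define a b where "a = p $ j" and "b = q $ i"
    define K where "K = UNIV - {i, j}"
    \<comment> \<open>Where the unfolded segment meets the ridge.\<close>
    define r :: "real^'n" where
      "r = (\<chi> k. if k \<in> K then (b * p $ k + a * q $ k + 2 * a * b / n) / (a + b) else 0)"
    define L where "L = sqrt ((a + b)\<^sup>2 + (\<Sum>k\<in>K. (p $ k - q $ k)\<^sup>2) + 4 * a * b / n)"
    have ij: "i \<noteq> j" using False p by auto
    have pos: "0 < a" "0 < b"
      using False p(1) q(1) by (auto simp: a_def b_def regular_simplex_def less_le)
    have card: "card K = n" using n ij by (simp add: K_def card_Diff_subset)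
    have ri: "r $ i = 0" "r $ j = 0" by (auto simp: r_def K_def)
    have rk: "r $ k = (b * p $ k + a * q $ k + 2 * a * b / n) / (a + b)" if "k \<in> K" for k
      using that by (simp add: r_def)
    have sums: "sum (($) p) K = 1 - a" "sum (($) q) K = 1 - b"
      using p q sum_UNIV_split_two[OF ij, of "($) p"] sum_UNIV_split_two[OF ij, of "($) q"]
      by (auto simp: regular_simplex_def K_def a_def b_def)
    have "sum (($) r) UNIV = (\<Sum>k\<in>K. (b * p $ k + a * q $ k + 2 * a * b / n) / (a + b))"
      using sum_UNIV_split_two[OF ij, of "($) r"] ri rk by (simp add: K_def)
    also have "\<dots> = (b * (1 - a) + a * (1 - b) + n * (2 * a * b / n)) / (a + b)"
      by (simp add: sum.distrib sums card flip: sum_divide_distrib sum_distrib_left)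
    also have "\<dots> = 1" using pos n by (simp add: field_simps)
    finally have r: "r \<in> regular_simplex"
      using p(1) q(1) pos by (auto simp: regular_simplex_def r_def)
    have L0: "0 \<le> L"
      unfolding L_def using pos by (intro real_sqrt_ge_zero add_nonneg_nonneg sum_nonneg) auto
    have L2: "L\<^sup>2 = (a + b)\<^sup>2 + (\<Sum>k\<in>K. (p $ k - q $ k)\<^sup>2) + 4 * a * b / n"
      unfolding L_def using pos by (intro real_sqrt_pow2 add_nonneg_nonneg sum_nonneg) auto
    have "(dist p r)\<^sup>2 = (a / (a + b) * L)\<^sup>2"
      unfolding power_mult_distrib L2 unfolding a_def b_def K_def
      by (rule power2_dist_folding_point[OF n p q ij])
        (use False pos ri rk in \<open>auto simp: a_def b_def K_def\<close>)
    then have pr: "dist p r = a / (a + b) * L"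
      using pos L0 by (subst (asm) power2_eq_iff_nonneg) auto
    have K': "K = UNIV - {j, i}" by (auto simp: K_def)
    have "(dist q r)\<^sup>2 = (q $ i / (q $ i + p $ j))\<^sup>2 *
     ((q $ i + p $ j)\<^sup>2 + (\<Sum>k\<in>UNIV - {j, i}. (q $ k - p $ k)\<^sup>2) + 4 * q $ i * p $ j / n)"
      by (rule power2_dist_folding_point[OF n q p ij[symmetric]])
        (use pos ri rk in \<open>auto simp: a_def b_def K' algebra_simps\<close>)
    also have "\<dots> = (b / (a + b) * L)\<^sup>2"
      unfolding power_mult_distrib L2
      by (simp add: a_def b_def K' add.commute mult.commute mult.left_commute power2_commute)
    finally have qr: "dist q r = b / (a + b) * L"
      using pos L0 by (subst (asm) power2_eq_iff_nonneg) auto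
    have "dist p r + dist r q = (a / (a + b) + b / (a + b)) * L"
      by (simp add: pr qr dist_commute[of r q] distrib_right)
    also have "\<dots> = L" using pos by (simp flip: add_divide_distrib)
    also have "L \<le> sqrt (2 + 2 / n) * dist p q"
    proof (rule power2_le_imp_le)
      show "L\<^sup>2 \<le> (sqrt (2 + 2 / n) * dist p q)\<^sup>2"
        unfolding L2 power_mult_distrib
        using folded_length_le[OF n(1) ij p(2) q(2)] by (simp add: a_def b_def K_def)
    qed simp
    finally have "ennreal (dist p r + dist r q) \<le> ennreal (sqrt (2 + 2 / n) * dist p q)"
      by (rule ennreal_leI)
    moreover have "intrinsic_dist simplex_boundary p q \<le> ennreal (dist p r + dist r q)"
      by (rule intrinsic_dist_le_via)
        (use closed_segment_subset_simplex_boundary p q r ri in blast)+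
    ultimately show ?thesis by (rule order_trans[rotated])
  qed
qed

text \<open>
  Going from \<open>p\<close> to the ridge moves the mass \<open>p $ j\<close> to the \<open>n\<close> remaining coordinates. By
  Cauchy-Schwarz this is cheapest if the mass is spread evenly over them.
\<close>

lemma dist_ridge_ge:
  fixes p x :: "real^'n::finite" and n :: nat
  assumes n: "n \<ge> 1" "CARD('n) = n + 2" and ij: "i \<noteq> j"
    and p: "p \<in> regular_simplex" "p $ i = 0" and x: "x \<in> regular_simplex" "x $ i = 0" "x $ j = 0"
  shows "p $ j * sqrt (1 + 1 / n) \<le> dist p x"
proof (rule power2_le_imp_le)
  define K where "K = UNIV - {i, j}"
  have card: "card K = n" using n ij by (simp add: K_def card_Diff_subset)
  have "(\<Sum>k\<in>UNIV. p $ k) = 1" "(\<Sum>k\<in>UNIV. x $ k) = 1"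
    using p x by (auto simp: regular_simplex_def)
  then have "(\<Sum>k\<in>K. p $ k - x $ k) = - p $ j"
    using sum_UNIV_split_two[OF ij, of "($) p"] sum_UNIV_split_two[OF ij, of "($) x"] p x
    by (simp add: K_def sum_subtractf)
  then have "(p $ j)\<^sup>2 \<le> n * (\<Sum>k\<in>K. (p $ k - x $ k)\<^sup>2)"
    using sum_squared_le_sum_of_squares[of "\<lambda>k. p $ k - x $ k" K] card by (simp add: mult.commute)
  then have "(p $ j)\<^sup>2 / n \<le> (\<Sum>k\<in>K. (p $ k - x $ k)\<^sup>2)"
    using n by (simp add: field_simps)
  then show "(p $ j * sqrt (1 + 1 / n))\<^sup>2 \<le> (dist p x)\<^sup>2"
    using power2_dist_vec_split_two[OF ij, of p x] p x
    by (simp add: K_def power_mult_distrib algebra_simps)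
qed simp

text \<open>
  The extremal points have mass \<open>a\<close> at one of the vertices \<open>i\<close>, \<open>j\<close> and the rest spread evenly
  over the \<open>n\<close> vertices of the opposite ridge. On a path between them the coordinates \<open>i\<close> and \<open>j\<close>
  agree at some point. If they vanish there, the path has met the ridge. Otherwise a different
  coordinate vanishes, and reaching such a point from either end costs at least \<open>(1 - a) / n\<close>.
\<close>

lemma distortion_simplex_boundary_ge:
  fixes n :: nat
  assumes n: "n \<ge> 1" "CARD('n::finite) = n + 2"
  shows "ennreal (sqrt (2 + 2 / n)) \<le> distortion (simplex_boundary :: (real^'n) set)"
proof -
  have "\<exists>i j :: 'n. i \<noteq> j"
    using n card_le_Suc0_iff_eq[of "UNIV :: 'n set"] by auto
  then obtain i j :: 'n where ij: "i \<noteq> j" by blast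
  \<comment> \<open>Small enough for a detour through a third facet, at least \<open>(1 - a) / n\<close>, to be
    no shorter than \<open>2 a\<close>, a bound for the distance to the ridge.\<close>
  define a where "a = 1 / (4 * real n)"
  define K where "K = UNIV - {i, j}"
  define c where "c = (\<lambda>k. if k \<in> K then (1 - a) / real n else 0)"
  define p q :: "real^'n" where "p = (\<chi> k. if k = j then a else c k)"
    and "q = (\<chi> k. if k = i then a else c k)"
  have card: "card K = n" using n ij by (simp add: K_def card_Diff_subset)
  have a: "0 < a" "a \<le> 1 / 4" using n by (auto simp: a_def field_simps)
  have [simp]: "c i = 0" "c j = 0" "p $ i = 0" "q $ j = 0" "p $ j = a" "q $ i = a"
    using ij by (auto simp: p_def q_def c_def K_def)
  have pk: "p $ k = (1 - a) / n" "q $ k = (1 - a) / n" if "k \<in> K" for k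
    using that by (auto simp: p_def q_def c_def K_def)
  have simplex: "p \<in> regular_simplex" "q \<in> regular_simplex"
    using sum_UNIV_split_two[OF ij, of "($) p"] sum_UNIV_split_two[OF ij, of "($) q"] pk n card a
    by (auto simp: regular_simplex_def K_def[symmetric]) (auto simp: p_def q_def c_def)
  have "(dist p q)\<^sup>2 = 2 * a\<^sup>2"
    using power2_dist_vec_split_two[OF ij, of p q] pk by (simp add: K_def[symmetric])
  then have d: "dist p q = sqrt 2 * a"
    using a by (metis abs_of_pos real_sqrt_abs real_sqrt_mult zero_le_dist abs_of_nonneg)
  have goal_eq: "sqrt (2 + 2 / n) * dist p q = 2 * (a * sqrt (1 + 1 / n))"
  proof -
    have "sqrt (2 + 2 / n) = sqrt 2 * sqrt (1 + 1 / n)"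
      by (simp flip: real_sqrt_mult add: algebra_simps)
    then show ?thesis by (simp add: d)
  qed
  show ?thesis
  proof (rule distortion_ge[of _ p _ q])
    show "ennreal (sqrt (2 + 2 / n) * dist p q) \<le> intrinsic_dist simplex_boundary p q"
      unfolding goal_eq
    proof (rule intrinsic_dist_ge)
      fix g :: "real \<Rightarrow> real^'n"
      assume g: "path g" "path_image g \<subseteq> simplex_boundary" "pathstart g = p" "pathfinish g = q"
      have "continuous_on {0..1} (\<lambda>t. g t $ i - g t $ j)"
        using g(1) by (auto simp: path_def intro!: continuous_intros)
      then have "\<exists>t\<ge>0. t \<le> 1 \<and> g t $ i - g t $ j = 0"
        by (intro IVT') (use g(3,4) a in \<open>auto simp: pathstart_def pathfinish_def\<close>)
      then obtain t where t: "t \<in> {0..1}" "g t $ i = g t $ j" by auto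
      define x where "x = g t"
      have "x \<in> simplex_boundary" using g(2) t(1) unfolding x_def path_image_def by blast
      then have x: "x \<in> regular_simplex" "\<exists>k. x $ k = 0" "x $ i = x $ j"
        using t(2) by (auto simp: x_def simplex_boundary_def)
      have "2 * (a * sqrt (1 + 1 / n)) \<le> dist p x + dist x q"
      proof (cases "x $ i = 0")
        case True
        show ?thesis
          using dist_ridge_ge[OF n ij simplex(1) _ x(1)] dist_ridge_ge[OF n ij[symmetric] simplex(2) _ x(1)]
            True x(3) by (simp add: dist_commute)
      next
        case False
        then obtain k where k: "k \<in> K" "x $ k = 0" using x(2,3) by (auto simp: K_def) metis
        have "a * sqrt (1 + 1 / n) \<le> a * 2"
          using a n by (intro mult_left_mono real_le_lsqrt) (auto simp: field_simps)
        also have "\<dots> \<le> (1 - a) / n"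
          using n a by (simp add: a_def field_simps)
        finally have "a * sqrt (1 + 1 / n) \<le> (1 - a) / n" .
        moreover have "\<bar>(p - x) $ k\<bar> = (1 - a) / n" "\<bar>(q - x) $ k\<bar> = (1 - a) / n"
          using k pk a by auto
        ultimately show ?thesis
          using component_le_norm_cart[of "p - x" k] component_le_norm_cart[of "q - x" k]
          by (simp add: dist_norm norm_minus_commute)
      qed
      then have "ennreal (2 * (a * sqrt (1 + 1 / n))) \<le> ennreal (dist p x + dist x q)"
        by (rule ennreal_leI)
      also have "\<dots> \<le> path_length g"
        using path_length_ge_via[OF t(1), of g] g by (simp add: x_def)
      finally show "ennreal (2 * (a * sqrt (1 + 1 / n))) \<le> path_length g" .
    qed
    show "p \<in> simplex_boundary" "q \<in> simplex_boundary"
      using simplex \<open>p $ i = 0\<close> \<open>q $ j = 0\<close> unfolding simplex_boundary_def by blast+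
    show "p \<noteq> q"
    proof
      assume "p = q"
      then have "p $ i = q $ i" by simp
      then show False using a by simp
    qed
  qed simp
qed

lemma distortion_simplex_boundary:
  fixes n :: nat
  assumes n: "n \<ge> 1" "CARD('n::finite) = n + 2"
  shows "distortion (simplex_boundary :: (real^'n) set) = ennreal (sqrt (2 + 2 / n))"
  by (intro antisym distortion_le distortion_simplex_boundary_ge
      intrinsic_dist_simplex_boundary_le assms) simp

section \<open>Two inequalities for the sine\<close>

lemma sin_less_self:
  fixes x :: real
  assumes "0 < x" "x \<le> pi"
  shows "sin x < x"
proof -
  have "0 < sin (x / 2)" using assms by (intro sin_gt_zero) auto
  moreover have "cos (x / 2) < 1"
    using cos_monotone_0_pi[of 0 "x / 2"] assms by simp
  ultimately have "2 * sin (x / 2) * cos (x / 2) < 2 * sin (x / 2)" by simp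
  also have "\<dots> \<le> x" using sin_x_le_x[of "x / 2"] assms by simp
  finally show ?thesis using sin_double[of "x / 2"] by simp
qed

text \<open>
  Concavity of the sine. It makes rolling a planar sector onto the cone a map that does not
  increase distances.
\<close>

lemma mult_sin_le_sin_mult:
  fixes k x :: real
  assumes "0 \<le> k" "k \<le> 1" "0 \<le> x" "x \<le> pi"
  shows "k * sin x \<le> sin (k * x)"
proof -
  have "sin (k * 0) - k * sin 0 \<le> sin (k * x) - k * sin x"
  proof (rule DERIV_nonneg_imp_nondecreasing[OF assms(3)])
    fix y assume y: "0 \<le> y" "y \<le> x"
    have "k * y \<le> y" using assms y by (simp add: mult_left_le_one_le)
    then have "cos y \<le> cos (k * y)"
      using assms y by (intro cos_monotone_0_pi_le) auto
    then have "0 \<le> k * (cos (k * y) - cos y)" using assms by simp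
    moreover have "((\<lambda>y. sin (k * y) - k * sin y) has_real_derivative k * (cos (k * y) - cos y)) (at y)"
      by (auto intro!: derivative_eq_intros simp: algebra_simps)
    ultimately show "\<exists>d. ((\<lambda>y. sin (k * y) - k * sin y) has_real_derivative d) (at y) \<and> 0 \<le> d"
      by blast
  qed
  then show ?thesis by simp
qed

text \<open>
  The quotient \<open>sin (k x) / sin x\<close> increases up to \<open>\<pi> / 2\<close>, since the numerator of its
  derivative is \<open>0\<close> at the origin and is itself increasing. Thus opposite points are the worst pair
  on the lateral surface of a cone.
\<close>

lemma sin_mult_le_mult_sin:
  fixes k x :: real
  assumes k: "0 \<le> k" "k \<le> 1" and x: "0 \<le> x" "x \<le> pi / 2"
  shows "sin (k * x) \<le> sin (k * (pi / 2)) * sin x"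
proof (cases "x = 0")
  case False
  have numerator: "0 \<le> k * cos (k * y) * sin y - sin (k * y) * cos y" if y: "0 \<le> y" "y \<le> pi" for y
  proof -
    have "k * cos (k * 0) * sin 0 - sin (k * 0) * cos 0 \<le> k * cos (k * y) * sin y - sin (k * y) * cos y"
    proof (rule DERIV_nonneg_imp_nondecreasing[OF y(1)])
      fix z assume z: "0 \<le> z" "z \<le> y"
      have "k * z \<le> pi" using k z y mult_mono[of k 1 z pi] by simp
      then have "0 \<le> (1 - k\<^sup>2) * (sin (k * z) * sin z)"
        using k z y by (intro mult_nonneg_nonneg sin_ge_zero) (auto simp: power_le_one)
      moreover have "((\<lambda>z. k * cos (k * z) * sin z - sin (k * z) * cos z)
          has_real_derivative (1 - k\<^sup>2) * (sin (k * z) * sin z)) (at z)"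
        by (auto intro!: derivative_eq_intros simp: algebra_simps power2_eq_square)
      ultimately show "\<exists>d. ((\<lambda>z. k * cos (k * z) * sin z - sin (k * z) * cos z)
          has_real_derivative d) (at z) \<and> 0 \<le> d" by blast
    qed
    then show ?thesis by simp
  qed
  have "sin (k * x) / sin x \<le> sin (k * (pi / 2)) / sin (pi / 2)"
  proof (rule DERIV_nonneg_imp_nondecreasing[OF x(2)])
    fix y assume y: "x \<le> y" "y \<le> pi / 2"
    have sin: "0 < sin y" using y x False by (intro sin_gt_zero) (auto simp: field_simps)
    have "((\<lambda>y. sin (k * y) / sin y) has_real_derivative
        (k * cos (k * y) * sin y - sin (k * y) * cos y) / (sin y)\<^sup>2) (at y)"
      using sin by (auto intro!: derivative_eq_intros simp: algebra_simps power2_eq_square)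
    moreover have "0 \<le> (k * cos (k * y) * sin y - sin (k * y) * cos y) / (sin y)\<^sup>2"
      using y x by (intro divide_nonneg_nonneg numerator) auto
    ultimately show "\<exists>d. ((\<lambda>y. sin (k * y) / sin y) has_real_derivative d) (at y) \<and> 0 \<le> d"
      by blast
  qed
  moreover have "0 < sin x" using x False by (intro sin_gt_zero) auto
  ultimately show ?thesis by (simp add: field_simps)
qed simp

lemma one_minus_cos_eq: "1 - cos x = 2 * (sin (\<bar>x\<bar> / 2))\<^sup>2" for x :: real
  using cos_double_sin[of "x / 2"] by (auto simp: abs_if)

lemma one_minus_cos_mult_ge:
  fixes k x :: real
  assumes "0 \<le> k" "k \<le> 1" "\<bar>x\<bar> \<le> pi"
  shows "k\<^sup>2 * (1 - cos x) \<le> 1 - cos (k * x)"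
proof -
  have "k * sin (\<bar>x\<bar> / 2) \<le> sin (k * (\<bar>x\<bar> / 2))"
    using assms by (intro mult_sin_le_sin_mult) auto
  moreover have "0 \<le> k * sin (\<bar>x\<bar> / 2)"
    using assms by (intro mult_nonneg_nonneg sin_ge_zero) auto
  ultimately have "(k * sin (\<bar>x\<bar> / 2))\<^sup>2 \<le> (sin (k * (\<bar>x\<bar> / 2)))\<^sup>2"
    by (rule power_mono)
  then show ?thesis
    using assms unfolding one_minus_cos_eq by (simp add: abs_mult power_mult_distrib)
qed

lemma one_minus_cos_mult_le:
  fixes k x :: real
  assumes "0 \<le> k" "k \<le> 1" "\<bar>x\<bar> \<le> pi"
  shows "1 - cos (k * x) \<le> (sin (k * (pi / 2)))\<^sup>2 * (1 - cos x)"
proof -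
  have "sin (k * (\<bar>x\<bar> / 2)) \<le> sin (k * (pi / 2)) * sin (\<bar>x\<bar> / 2)"
    using assms by (intro sin_mult_le_mult_sin) auto
  moreover have "k * (\<bar>x\<bar> / 2) \<le> 1 * pi"
    using assms by (intro mult_mono) auto
  then have "0 \<le> sin (k * (\<bar>x\<bar> / 2))"
    using assms by (intro sin_ge_zero) auto
  ultimately have "(sin (k * (\<bar>x\<bar> / 2)))\<^sup>2 \<le> (sin (k * (pi / 2)) * sin (\<bar>x\<bar> / 2))\<^sup>2"
    by (intro power_mono)
  then show ?thesis
    using assms unfolding one_minus_cos_eq by (simp add: abs_mult power_mult_distrib)
qed

section \<open>The cone\<close>

text \<open>
  The sine of the angle between the axis and the generators: a point at distance \<open>s\<close> from the apex
  is \<open>apex_sin h * s\<close> away from the axis, and the lateral surface unrolls to a sector of angle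
  \<open>2 * pi * apex_sin h\<close>.
\<close>

definition apex_sin :: "real \<Rightarrow> real" where
  "apex_sin h = 1 / sqrt (1 + h\<^sup>2)"

text \<open>
  Polar coordinates on the cone: \<open>s\<close> is the distance from the apex and \<open>a\<close> the angle around the axis.
\<close>

definition cone_point :: "real \<Rightarrow> real \<Rightarrow> real \<Rightarrow> real^3" where
  "cone_point h s a = (apex_sin h * s) *\<^sub>R vector [cos a, sin a, h]"

lemma cone_point_component [simp]:
  "cone_point h s a $ 1 = apex_sin h * s * cos a"
  "cone_point h s a $ 2 = apex_sin h * s * sin a"
  "cone_point h s a $ 3 = apex_sin h * s * h"
  by (simp_all add: cone_point_def)

lemma apex_sin_pos: "0 < apex_sin h"
  by (simp add: apex_sin_def add_pos_nonneg)

lemma apex_sin_le_1: "apex_sin h \<le> 1"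
proof -
  have "1 / sqrt (1 + h\<^sup>2) \<le> 1 / 1" by (rule frac_le) auto
  then show ?thesis by (simp add: apex_sin_def)
qed

lemma apex_sin_sq: "(apex_sin h)\<^sup>2 * (1 + h\<^sup>2) = 1"
proof -
  have "0 < 1 + h\<^sup>2" by (simp add: add_pos_nonneg)
  then show ?thesis by (simp add: apex_sin_def power_divide)
qed

lemma power2_dist_vec3: "(dist x y)\<^sup>2 = (x$1 - y$1)\<^sup>2 + (x$2 - y$2)\<^sup>2 + (x$3 - y$3)\<^sup>2"
  for x y :: "real^3"
  unfolding dist_norm power2_norm_eq_inner by (simp add: inner_vec_def sum_3 power2_eq_square)

lemma power2_dist_polar:
  "(s * cos a - t * cos b)\<^sup>2 + (s * sin a - t * sin b)\<^sup>2 = (s - t)\<^sup>2 + 2 * s * t * (1 - cos (a - b))"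
  for s t a b :: real
proof -
  have "(s * cos a - t * cos b)\<^sup>2 + (s * sin a - t * sin b)\<^sup>2
    = s\<^sup>2 * ((sin a)\<^sup>2 + (cos a)\<^sup>2) + t\<^sup>2 * ((sin b)\<^sup>2 + (cos b)\<^sup>2)
      - 2 * s * t * (cos a * cos b + sin a * sin b)"
    by algebra
  also have "\<dots> = s\<^sup>2 + t\<^sup>2 - 2 * s * t * cos (a - b)" by (simp add: cos_diff)
  also have "\<dots> = (s - t)\<^sup>2 + 2 * s * t * (1 - cos (a - b))" by (simp add: power2_diff algebra_simps)
  finally show ?thesis .
qed

text \<open>
  Compare with \<open>power2_dist_cis\<close>: unrolling to the planar point with polar coordinates \<open>s\<close> and
  \<open>apex_sin h * a\<close> replaces \<open>(apex_sin h)\<^sup>2 * (1 - cos \<phi>)\<close> by \<open>1 - cos (apex_sin h * \<phi>)\<close>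
  in the law of cosines, \<open>\<phi>\<close> being the difference of the angles. All comparisons of cone and sector
  rest on these two terms.
\<close>

lemma power2_dist_cone_point:
  "(dist (cone_point h s a) (cone_point h t b))\<^sup>2
    = (s - t)\<^sup>2 + 2 * s * t * ((apex_sin h)\<^sup>2 * (1 - cos (a - b)))"
proof -
  let ?k = "apex_sin h"
  have "(dist (cone_point h s a) (cone_point h t b))\<^sup>2
      = ?k\<^sup>2 * ((s * cos a - t * cos b)\<^sup>2 + (s * sin a - t * sin b)\<^sup>2 + h\<^sup>2 * (s - t)\<^sup>2)"
    unfolding power2_dist_vec3 by (simp add: power2_eq_square algebra_simps)
  also have "\<dots> = (?k\<^sup>2 * (1 + h\<^sup>2)) * (s - t)\<^sup>2 + 2 * s * t * (?k\<^sup>2 * (1 - cos (a - b)))"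
    unfolding power2_dist_polar by (simp add: algebra_simps)
  finally show ?thesis by (simp add: apex_sin_sq)
qed

lemma power2_dist_cis:
  "(dist (of_real s * cis a) (of_real t * cis b))\<^sup>2 = (s - t)\<^sup>2 + 2 * s * t * (1 - cos (a - b))"
  unfolding dist_norm cmod_power2 using power2_dist_polar[of s a t b] by simp

lemma dist_cone_point_le_dist_cis:
  assumes "0 \<le> s" "0 \<le> t" "\<bar>a - b\<bar> \<le> pi"
  shows "dist (cone_point h s a) (cone_point h t b)
    \<le> dist (of_real s * cis (apex_sin h * a)) (of_real t * cis (apex_sin h * b))"
proof (rule power2_le_imp_le)
  have "(apex_sin h)\<^sup>2 * (1 - cos (a - b)) \<le> 1 - cos (apex_sin h * (a - b))"
    using apex_sin_pos[of h] apex_sin_le_1[of h] assms by (intro one_minus_cos_mult_ge) auto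
  then show "(dist (cone_point h s a) (cone_point h t b))\<^sup>2
    \<le> (dist (of_real s * cis (apex_sin h * a)) (of_real t * cis (apex_sin h * b)))\<^sup>2"
    unfolding power2_dist_cone_point power2_dist_cis right_diff_distrib[symmetric]
    using assms by (intro add_left_mono mult_left_mono) auto
qed simp

text \<open>
  Equality holds for two opposite points at equal distance from the apex.
\<close>

lemma dist_cis_le_dist_cone_point:
  assumes "0 \<le> s" "0 \<le> t" "\<bar>a - b\<bar> \<le> pi"
  shows "dist (of_real s * cis (apex_sin h * a)) (of_real t * cis (apex_sin h * b))
    \<le> sin (apex_sin h * (pi / 2)) / apex_sin h * dist (cone_point h s a) (cone_point h t b)"
proof (rule power2_le_imp_le)
  define k where "k = apex_sin h"
  define S where "S = sin (k * (pi / 2))"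
  have k: "0 < k" "k \<le> 1" using apex_sin_pos[of h] apex_sin_le_1[of h] by (auto simp: k_def)
  have "k \<le> S" using mult_sin_le_sin_mult[of k "pi / 2"] k by (simp add: S_def)
  then have C: "1 \<le> S / k" using k by simp
  have "1 - cos (k * (a - b)) \<le> S\<^sup>2 * (1 - cos (a - b))"
    unfolding S_def using k assms by (intro one_minus_cos_mult_le) auto
  also have "\<dots> = (S / k)\<^sup>2 * (k\<^sup>2 * (1 - cos (a - b)))"
    using k by (simp add: power_divide)
  finally have "2 * s * t * (1 - cos (k * (a - b)))
      \<le> 2 * s * t * ((S / k)\<^sup>2 * (k\<^sup>2 * (1 - cos (a - b))))"
    using assms by (intro mult_left_mono) auto
  moreover have "1 * (s - t)\<^sup>2 \<le> (S / k)\<^sup>2 * (s - t)\<^sup>2"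
    using C by (intro mult_right_mono) auto
  ultimately have "(s - t)\<^sup>2 + 2 * s * t * (1 - cos (k * (a - b)))
     \<le> (S / k)\<^sup>2 * ((s - t)\<^sup>2 + 2 * s * t * (k\<^sup>2 * (1 - cos (a - b))))"
    by (simp add: algebra_simps)
  then show "(dist (of_real s * cis (apex_sin h * a)) (of_real t * cis (apex_sin h * b)))\<^sup>2
    \<le> (sin (apex_sin h * (pi / 2)) / apex_sin h
        * dist (cone_point h s a) (cone_point h t b))\<^sup>2"
    unfolding power_mult_distrib power2_dist_cone_point power2_dist_cis
      right_diff_distrib[symmetric] k_def[symmetric] S_def[symmetric] .
  show "0 \<le> sin (apex_sin h * (pi / 2)) / apex_sin h
        * dist (cone_point h s a) (cone_point h t b)"
    using C unfolding k_def S_def by (intro mult_nonneg_nonneg) auto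
qed

lemma cone_point_in_lateral:
  assumes "0 < h" "0 \<le> s" "apex_sin h * s \<le> 1"
  shows "cone_point h s a \<in> cone_lateral h"
proof -
  have "(apex_sin h * s * cos a)\<^sup>2 + (apex_sin h * s * sin a)\<^sup>2
      = (apex_sin h * s)\<^sup>2 * ((sin a)\<^sup>2 + (cos a)\<^sup>2)"
    by (simp only: power_mult_distrib distrib_left add.commute)
  also have "\<dots> = (apex_sin h * s * h)\<^sup>2 / h\<^sup>2"
    using assms by (simp add: power_mult_distrib)
  finally show ?thesis
    using assms apex_sin_pos[of h] by (auto simp: cone_lateral_def mult_left_le_one_le)
qed

text \<open>
  The angle of a point is determined up to full turns only; it can be chosen within a half turn of
  any prescribed \<open>c\<close>, which is where the bounds for unrolling are valid.
\<close>

lemma cone_lateral_polar: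
  assumes h: "0 < h" and v: "v \<in> cone_lateral h"
  obtains s a where "0 \<le> s" "apex_sin h * s \<le> 1" "\<bar>c - a\<bar> \<le> pi" "v = cone_point h s a"
proof -
  define z where "z = Complex (v$1) (v$2)"
  \<comment> \<open>Rotating by \<open>-c\<close> first makes the principal argument measure the angle from \<open>c\<close>.\<close>
  define a where "a = c + Arg (z * cis (- c))"
  define s where "s = cmod z / apex_sin h"
  have k: "0 < apex_sin h" by (rule apex_sin_pos)
  have z: "z = of_real (cmod z) * cis a"
  proof -
    have "z * cis (- c) = of_real (cmod z) * cis (Arg (z * cis (- c)))"
      using rcis_cmod_Arg[of "z * cis (- c)"] by (simp add: rcis_def norm_mult)
    then have "z * cis (- c) * cis c = of_real (cmod z) * (cis (Arg (z * cis (- c))) * cis c)"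
      by simp
    then show ?thesis by (simp add: a_def cis_mult mult.assoc add.commute)
  qed
  have "Re z = cmod z * cos a" "Im z = cmod z * sin a"
    using arg_cong[OF z, of Re] arg_cong[OF z, of Im] by simp_all
  then have xy: "v$1 = cmod z * cos a" "v$2 = cmod z * sin a" by (simp_all add: z_def)
  have "(cmod z)\<^sup>2 = (v$3 / h)\<^sup>2"
    using v by (simp add: cmod_power2 z_def cone_lateral_def power_divide)
  then have r: "cmod z = v$3 / h"
    using v h by (subst (asm) power2_eq_iff_nonneg) (auto simp: cone_lateral_def)
  show thesis
  proof
    show "0 \<le> s" using k by (simp add: s_def)
    show "apex_sin h * s \<le> 1" using k r v h by (simp add: s_def cone_lateral_def)
    show "\<bar>c - a\<bar> \<le> pi" using Arg_bounded[of "z * cis (- c)"] by (auto simp: a_def abs_le_iff)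
    show "v = cone_point h s a"
      using xy r h k by (simp add: vec_eq_iff forall_3 s_def)
  qed
qed

text \<open>
  A sector of at most a right angle is convex. The direction \<open>\<gamma>\<close> is one for which the component
  orthogonal to it vanishes; it exists by the intermediate value theorem. This avoids
  case distinctions for the argument at the origin.
\<close>

lemma convex_combination_cis:
  fixes u v \<alpha> \<beta> :: real
  assumes "0 \<le> u" "0 \<le> v" "\<alpha> \<le> \<beta>" "\<beta> - \<alpha> \<le> pi / 2"
  shows "\<exists>s \<gamma>. 0 \<le> s \<and> \<alpha> \<le> \<gamma> \<and> \<gamma> \<le> \<beta> \<and> of_real u * cis \<alpha> + of_real v * cis \<beta> = of_real s * cis \<gamma>"
proof -
  have "\<exists>\<gamma>\<ge>\<alpha>. \<gamma> \<le> \<beta> \<and> u * sin (\<alpha> - \<gamma>) + v * sin (\<beta> - \<gamma>) = 0"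
  proof (rule IVT2')
    show "u * sin (\<alpha> - \<beta>) + v * sin (\<beta> - \<beta>) \<le> 0"
      using assms sin_ge_zero[of "\<beta> - \<alpha>"] sin_minus[of "\<beta> - \<alpha>"] by (simp add: mult_nonneg_nonpos)
    show "0 \<le> u * sin (\<alpha> - \<alpha>) + v * sin (\<beta> - \<alpha>)"
      using assms sin_ge_zero[of "\<beta> - \<alpha>"] by simp
  qed (use assms in \<open>auto intro!: continuous_intros\<close>)
  then obtain \<gamma> where \<gamma>: "\<alpha> \<le> \<gamma>" "\<gamma> \<le> \<beta>" "u * sin (\<alpha> - \<gamma>) + v * sin (\<beta> - \<gamma>) = 0" by blast
  define s where "s = u * cos (\<alpha> - \<gamma>) + v * cos (\<beta> - \<gamma>)"
  have "0 \<le> s"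
    unfolding s_def using assms \<gamma> by (intro add_nonneg_nonneg mult_nonneg_nonneg cos_ge_zero) auto
  moreover have "of_real u * cis \<alpha> + of_real v * cis \<beta> = of_real s * cis \<gamma>"
  proof -
    have "of_real u * cis (\<alpha> - \<gamma>) + of_real v * cis (\<beta> - \<gamma>) = of_real s"
      using \<gamma>(3) by (simp add: complex_eq_iff s_def)
    then have "(of_real u * cis (\<alpha> - \<gamma>) + of_real v * cis (\<beta> - \<gamma>)) * cis \<gamma> = of_real s * cis \<gamma>"
      by simp
    then show ?thesis by (simp add: distrib_right mult.assoc cis_mult)
  qed
  ultimately show ?thesis using \<gamma> by blast
qed

text \<open>
  Roll the planar segment between the unrolled points onto the cone. As the angle at the
  axis is at most \<open>pi / 6\<close>, half of the unrolled surface fits into a right angle, and the segment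
  stays in the sector.
\<close>

lemma intrinsic_dist_cone_points_le:
  assumes h: "0 < h" and half: "apex_sin h \<le> 1 / 2"
    and s: "0 \<le> s0" "apex_sin h * s0 \<le> 1" "0 \<le> s1" "apex_sin h * s1 \<le> 1"
    and a: "\<bar>a0 - a1\<bar> \<le> pi" and A: "cone_lateral h \<subseteq> A"
  shows "intrinsic_dist A (cone_point h s0 a0) (cone_point h s1 a1)
    \<le> ennreal (dist (of_real s0 * cis (apex_sin h * a0)) (of_real s1 * cis (apex_sin h * a1)))"
proof -
  define k where "k = apex_sin h"
  have k: "0 < k" "k \<le> 1 / 2" using half apex_sin_pos by (auto simp: k_def)
  define c where "c = linepath (of_real s0 * cis (k * a0)) (of_real s1 * cis (k * a1))"
  have "\<exists>s b. 0 \<le> s \<and> k * s \<le> 1 \<and> min a0 a1 \<le> b \<and> b \<le> max a0 a1 \<and> c t = of_real s * cis (k * b)"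
    if t: "t \<in> {0..1}" for t
  proof -
    have ct: "c t = of_real ((1 - t) * s0) * cis (k * a0) + of_real (t * s1) * cis (k * a1)"
      by (simp add: c_def linepath_def scaleR_conv_of_real)
    have "k * \<bar>a0 - a1\<bar> \<le> (1 / 2) * pi" using k a by (intro mult_mono) auto
    then have d: "\<bar>k * a0 - k * a1\<bar> \<le> pi / 2"
      using k by (simp add: right_diff_distrib[symmetric] abs_mult)
    have "\<exists>s \<gamma>. 0 \<le> s \<and> k * min a0 a1 \<le> \<gamma> \<and> \<gamma> \<le> k * max a0 a1 \<and> c t = of_real s * cis \<gamma>"
    proof (cases "a0 \<le> a1")
      case True
      then show ?thesis
        unfolding ct using convex_combination_cis[of "(1 - t) * s0" "t * s1" "k * a0" "k * a1"] t s k d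
        by (auto simp: min_def max_def)
    next
      case False
      then show ?thesis
        unfolding ct using convex_combination_cis[of "t * s1" "(1 - t) * s0" "k * a1" "k * a0"] t s k d
        by (auto simp: min_def max_def add.commute)
    qed
    then obtain r \<gamma> where r: "0 \<le> r" "k * min a0 a1 \<le> \<gamma>" "\<gamma> \<le> k * max a0 a1" "c t = of_real r * cis \<gamma>"
      by blast
    have "r = norm (c t)" using r by (simp add: norm_mult)
    also have "\<dots> \<le> (1 - t) * s0 + t * s1"
      unfolding ct by (rule norm_triangle_le) (use t s in \<open>simp add: norm_mult del: of_real_mult\<close>)
    finally have "k * r \<le> k * ((1 - t) * s0 + t * s1)" using k by simp
    also have "\<dots> = (1 - t) * (k * s0) + t * (k * s1)" by (simp add: algebra_simps)
    also have "\<dots> \<le> 1"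
      using t s by (intro convex_bound_le) (auto simp: k_def)
    finally have "k * r \<le> 1" .
    then show ?thesis
      using r k by (intro exI[of _ r] exI[of _ "\<gamma> / k"]) (auto simp: field_simps)
  qed
  then obtain s b where sb: "\<And>t. t \<in> {0..1} \<Longrightarrow> 0 \<le> s t" "\<And>t. t \<in> {0..1} \<Longrightarrow> k * s t \<le> 1"
      "\<And>t. t \<in> {0..1} \<Longrightarrow> min a0 a1 \<le> b t" "\<And>t. t \<in> {0..1} \<Longrightarrow> b t \<le> max a0 a1"
      "\<And>t. t \<in> {0..1} \<Longrightarrow> c t = of_real (s t) * cis (k * b t)"
    by metis
  define g where "g = (\<lambda>t. cone_point h (s t) (b t))"
  \<comment> \<open>The chosen polar coordinates may differ from the given ones (at the apex they are not unique),
    but equal planar points have equal images because rolling does not increase distances.\<close>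
  have ends: "g 0 = cone_point h s0 a0" "g 1 = cone_point h s1 a1"
  proof -
    have "dist (g 0) (cone_point h s0 a0) \<le> dist (of_real (s 0) * cis (k * b 0)) (of_real s0 * cis (k * a0))"
      unfolding g_def k_def by (rule dist_cone_point_le_dist_cis) (use sb[of 0] s a in auto)
    also have "\<dots> = 0" by (simp add: sb(5)[of 0, symmetric] c_def linepath_def)
    finally show "g 0 = cone_point h s0 a0" by simp
    have "dist (g 1) (cone_point h s1 a1) \<le> dist (of_real (s 1) * cis (k * b 1)) (of_real s1 * cis (k * a1))"
      unfolding g_def k_def by (rule dist_cone_point_le_dist_cis) (use sb[of 1] s a in auto)
    also have "\<dots> = 0" by (simp add: sb(5)[of 1, symmetric] c_def linepath_def)
    finally show "g 1 = cone_point h s1 a1" by simp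
  qed
  let ?L = "dist (of_real s0 * cis (k * a0)) (of_real s1 * cis (k * a1))"
  have lip: "?L-lipschitz_on {0..1} g"
  proof (rule lipschitz_onI)
    fix t u :: real assume tu: "t \<in> {0..1}" "u \<in> {0..1}"
    have "dist (g t) (g u) \<le> dist (c t) (c u)"
      unfolding sb(5)[OF tu(1)] sb(5)[OF tu(2)] g_def k_def
      by (rule dist_cone_point_le_dist_cis) (use sb[OF tu(1)] sb[OF tu(2)] a in auto)
    also have "c t - c u = (t - u) *\<^sub>R (of_real s1 * cis (k * a1) - of_real s0 * cis (k * a0))"
      by (simp add: c_def linepath_def algebra_simps)
    then have "dist (c t) (c u) = ?L * dist t u"
      by (simp add: dist_norm norm_minus_commute)
    finally show "dist (g t) (g u) \<le> ?L * dist t u" .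
  qed simp
  show ?thesis
    unfolding k_def[symmetric]
  proof (rule intrinsic_dist_le[of g])
    show "path g" unfolding path_def by (rule lipschitz_on_continuous_on[OF lip])
    show "path_image g \<subseteq> A"
      using A cone_point_in_lateral[OF h] sb by (auto simp: path_image_def g_def k_def)
    show "path_length g \<le> ennreal ?L" by (rule path_length_le_lipschitz[OF lip])
  qed (use ends in \<open>auto simp: pathstart_def pathfinish_def\<close>)
qed

lemma convex_cone_base: "convex (cone_base h)"
proof -
  have "convex_on UNIV (\<lambda>x::real. x\<^sup>2)" by (rule convex_power2)
  then have sq: "(u * x + v * y)\<^sup>2 \<le> u * x\<^sup>2 + v * y\<^sup>2" if "0 \<le> u" "0 \<le> v" "u + v = 1" for u v x y :: real
    using that by (auto simp: convex_on_def)
  show ?thesis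
  proof (rule convexI)
    fix x y :: "real^3" and u v :: real
    assume *: "x \<in> cone_base h" "y \<in> cone_base h" "0 \<le> u" "0 \<le> v" "u + v = 1"
    have "(u * x$1 + v * y$1)\<^sup>2 + (u * x$2 + v * y$2)\<^sup>2
        \<le> u * ((x$1)\<^sup>2 + (x$2)\<^sup>2) + v * ((y$1)\<^sup>2 + (y$2)\<^sup>2)"
      using sq[OF *(3-5), of "x$1" "y$1"] sq[OF *(3-5), of "x$2" "y$2"] by (simp add: algebra_simps)
    also have "\<dots> \<le> 1" using * by (intro convex_bound_le) (auto simp: cone_base_def)
    finally show "u *\<^sub>R x + v *\<^sub>R y \<in> cone_base h"
      using * by (simp add: cone_base_def flip: distrib_right)
  qed
qed

text \<open>
  The path goes along the generator through \<open>p\<close> to the rim and then straight to \<open>q\<close>. If \<open>p\<close> lies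
  at depth \<open>h * w\<close> below the base, the first part has length at most \<open>(1 + h) * w\<close>, and moving from
  the point \<open>P\<close> of the base plane above \<open>p\<close> to the rim costs another \<open>w\<close>. Since \<open>2 * w\<close> is at
  most a tenth of \<open>h * w\<close>, what remains is to compare \<open>11 / 10 * u + D\<close> with the hypotenuse over
  the legs \<open>u = h * w\<close> and \<open>D\<close>; the constant \<open>3 / 2\<close> leaves room on both sides.
\<close>

lemma cone_base_lateral_route:
  assumes h: "20 \<le> h" and p: "p \<in> cone_lateral h" and q: "q \<in> cone_base h"
  obtains r where "closed_segment p r \<subseteq> cone_surface h" "closed_segment r q \<subseteq> cone_surface h"
    "dist p r + dist r q \<le> 3 / 2 * dist p q"
proof -
  define k where "k = apex_sin h"
  have k: "0 < k" using apex_sin_pos by (simp add: k_def)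
  have inv_k: "1 / k \<le> 1 + h"
    using h by (simp add: k_def apex_sin_def real_le_lsqrt power2_eq_square algebra_simps)
  obtain s a where s: "0 \<le> s" "k * s \<le> 1" and pa: "p = cone_point h s a"
    using cone_lateral_polar[OF _ p] h unfolding k_def by (metis less_le_trans zero_less_numeral)
  define r where "r = cone_point h (1 / k) a"
  define w where "w = 1 - k * s"
  have w: "0 \<le> w" using s by (simp add: w_def)
  show thesis
  proof
    have "closed_segment p r \<subseteq> cone_lateral h"
    proof
      fix x assume "x \<in> closed_segment p r"
      then obtain u where u: "0 \<le> u" "u \<le> 1" "x = (1 - u) *\<^sub>R p + u *\<^sub>R r"
        by (auto simp: in_segment)
      then have x: "x = cone_point h ((1 - u) * s + u * (1 / k)) a"
        by (simp add: pa r_def vec_eq_iff forall_3 algebra_simps)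
      have "k * ((1 - u) * s + u * (1 / k)) = (1 - u) * (k * s) + u * 1"
        using k by (simp add: algebra_simps)
      also have "\<dots> \<le> 1" using s u by (intro convex_bound_le) auto
      finally show "x \<in> cone_lateral h"
        unfolding x using h s u k by (intro cone_point_in_lateral) (auto simp: k_def)
    qed
    then show "closed_segment p r \<subseteq> cone_surface h" by (auto simp: cone_surface_def)
    have "r \<in> cone_base h" using k by (simp add: cone_base_def r_def k_def[symmetric])
    then have "closed_segment r q \<subseteq> cone_base h"
      by (intro closed_segment_subset q convex_cone_base)
    then show "closed_segment r q \<subseteq> cone_surface h" by (auto simp: cone_surface_def)
    define P :: "real^3" where "P = vector [p$1, p$2, h]"
    define D where "D = dist P q"
    have "(dist p r)\<^sup>2 = (1 / k - s)\<^sup>2"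
      unfolding pa r_def power2_dist_cone_point by (simp add: power2_commute)
    then have "dist p r = 1 / k - s"
      using k s by (subst (asm) power2_eq_iff_nonneg) (auto simp: field_simps)
    also have "\<dots> = w * (1 / k)" using k by (simp add: w_def field_simps)
    also have "\<dots> \<le> w * (1 + h)" using w inv_k by (rule mult_left_mono[rotated])
    finally have pr: "dist p r \<le> w * (1 + h)" .
    have "r$1 - P$1 = w * cos a" "r$2 - P$2 = w * sin a" "r$3 - P$3 = 0"
      using k by (simp_all add: r_def P_def pa k_def[symmetric] w_def algebra_simps)
    then have "(dist r P)\<^sup>2 = w\<^sup>2 * ((sin a)\<^sup>2 + (cos a)\<^sup>2)"
      unfolding power2_dist_vec3 by (simp only: power_mult_distrib) (simp flip: distrib_left)
    then have "dist r P = w"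
      using w by (simp add: power2_eq_iff_nonneg)
    then have rq: "dist r q \<le> w + D" using dist_triangle[of r q P] by (simp add: D_def)
    have pq: "(dist p q)\<^sup>2 = D\<^sup>2 + (h * w)\<^sup>2"
      using q unfolding D_def power2_dist_vec3
      by (simp add: P_def pa k_def[symmetric] w_def cone_base_def power2_eq_square algebra_simps)
    have route: "dist p r + dist r q \<le> 11 / 10 * (h * w) + D"
    proof -
      have "2 * w \<le> h / 10 * w" using h w by (intro mult_right_mono) auto
      then show ?thesis using pr rq by (simp add: algebra_simps)
    qed
    have "(11 / 10 * u + D)\<^sup>2 \<le> (3 / 2)\<^sup>2 * (D\<^sup>2 + u\<^sup>2)" for u
    proof -
      \<comment> \<open>Cauchy-Schwarz with the remainder \<open>9 / 4 - 221 / 100 = 4 / 100\<close>.\<close>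
      have "0 \<le> (11 / 10 * D - u)\<^sup>2 + 4 / 100 * u\<^sup>2 + 4 / 100 * D\<^sup>2" by simp
      then show ?thesis by (simp add: power2_eq_square algebra_simps)
    qed
    then have "(11 / 10 * (h * w) + D)\<^sup>2 \<le> (3 / 2 * dist p q)\<^sup>2"
      unfolding power_mult_distrib[of "3 / 2" "dist p q"] pq .
    then have "11 / 10 * (h * w) + D \<le> 3 / 2 * dist p q"
      by (rule power2_le_imp_le) simp
    then show "dist p r + dist r q \<le> 3 / 2 * dist p q"
      using route by linarith
  qed
qed

lemma distortion_cone_surface_le:
  assumes h: "20 \<le> h"
  shows "distortion (cone_surface h)
    \<le> ennreal (max (3 / 2) (sin (apex_sin h * (pi / 2)) / apex_sin h))" (is "_ \<le> ennreal ?C")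
proof (rule distortion_le)
  fix p q assume pq: "p \<in> cone_surface h" "q \<in> cone_surface h" "p \<noteq> q"
  have h0: "0 < h" using h by simp
  consider "p \<in> cone_base h" "q \<in> cone_base h" | "p \<in> cone_lateral h" "q \<in> cone_base h"
    | "p \<in> cone_base h" "q \<in> cone_lateral h" | "p \<in> cone_lateral h" "q \<in> cone_lateral h"
    using pq by (auto simp: cone_surface_def)
  then have "\<exists>d \<le> ?C * dist p q. intrinsic_dist (cone_surface h) p q \<le> ennreal d"
  proof cases
    case 1
    have "intrinsic_dist (cone_surface h) p q \<le> ennreal (dist p q)"
      using closed_segment_subset[OF 1 convex_cone_base]
      by (intro intrinsic_dist_le_segment) (auto simp: cone_surface_def)
    moreover have "1 * dist p q \<le> ?C * dist p q" by (intro mult_right_mono) auto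
    ultimately show ?thesis by auto
  next
    case 2
    obtain r where r: "closed_segment p r \<subseteq> cone_surface h" "closed_segment r q \<subseteq> cone_surface h"
      "dist p r + dist r q \<le> 3 / 2 * dist p q"
      using cone_base_lateral_route[OF h 2] by metis
    have "3 / 2 * dist p q \<le> ?C * dist p q" by (intro mult_right_mono) auto
    then show ?thesis using intrinsic_dist_le_via[OF r(1,2)] r(3) by (meson order_trans)
  next
    case 3
    obtain r where r: "closed_segment q r \<subseteq> cone_surface h" "closed_segment r p \<subseteq> cone_surface h"
      "dist q r + dist r p \<le> 3 / 2 * dist q p"
      using cone_base_lateral_route[OF h 3(2,1)] by metis
    have "3 / 2 * dist p q \<le> ?C * dist p q" by (intro mult_right_mono) auto
    then have "dist p r + dist r q \<le> ?C * dist p q" using r(3) by (simp add: dist_commute)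
    moreover have "intrinsic_dist (cone_surface h) p q \<le> ennreal (dist p r + dist r q)"
      using r by (intro intrinsic_dist_le_via) (auto simp: closed_segment_commute)
    ultimately show ?thesis by blast
  next
    case 4
    obtain s0 a0 where p: "0 \<le> s0" "apex_sin h * s0 \<le> 1" "p = cone_point h s0 a0"
      by (rule cone_lateral_polar[OF h0 4(1), of 0])
    obtain s1 a1 where q: "0 \<le> s1" "apex_sin h * s1 \<le> 1" "\<bar>a0 - a1\<bar> \<le> pi" "q = cone_point h s1 a1"
      by (rule cone_lateral_polar[OF h0 4(2), of a0])
    have "2 \<le> sqrt (1 + h\<^sup>2)" using h power_mono[of 20 h 2] by (intro real_le_rsqrt) auto
    then have "1 / sqrt (1 + h\<^sup>2) \<le> 1 / 2" by (intro frac_le) auto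
    then have half: "apex_sin h \<le> 1 / 2" by (simp add: apex_sin_def)
    let ?d = "dist (of_real s0 * cis (apex_sin h * a0)) (of_real s1 * cis (apex_sin h * a1))"
    have "intrinsic_dist (cone_surface h) p q \<le> ennreal ?d"
      unfolding p(3) q(4) using h0 half p q
      by (intro intrinsic_dist_cone_points_le) (auto simp: cone_surface_def)
    moreover have "?d \<le> sin (apex_sin h * (pi / 2)) / apex_sin h * dist p q"
      unfolding p(3) q(4) using p q by (intro dist_cis_le_dist_cone_point)
    moreover have "\<dots> \<le> ?C * dist p q" by (intro mult_right_mono) auto
    ultimately show ?thesis by (meson order_trans)
  qed
  then show "intrinsic_dist (cone_surface h) p q \<le> ennreal (?C * dist p q)"
    by (meson ennreal_leI order_trans)
qed simp

lemma distortion_cone_surface_less: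
  assumes "20 \<le> h"
  shows "distortion (cone_surface h) < ennreal (pi / 2)"
proof -
  have "sin (apex_sin h * (pi / 2)) < apex_sin h * (pi / 2)"
    using apex_sin_pos[of h] apex_sin_le_1[of h] mult_right_mono[of "apex_sin h" 1 "pi / 2"]
    by (intro sin_less_self) auto
  then have "sin (apex_sin h * (pi / 2)) / apex_sin h < pi / 2"
    using apex_sin_pos[of h] by (simp add: field_simps)
  moreover have "3 / 2 < pi / 2" using pi_approx by simp
  ultimately have "ennreal (max (3 / 2) (sin (apex_sin h * (pi / 2)) / apex_sin h)) < ennreal (pi / 2)"
    by (simp add: ennreal_less_iff)
  then show ?thesis using distortion_cone_surface_le[OF assms] by (rule le_less_trans[rotated])
qed

section \<open>Comparison of the distortions\<close>

theorem theorem1: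
  shows
    "(\<exists>H>0. \<forall>h\<ge>H. distortion (cone_surface h) < ennreal (pi / 2))
     \<and> (\<forall>n::nat. n \<ge> 1 \<and> CARD('n::finite) = n + 2 \<longrightarrow>
          distortion (simplex_boundary :: (real^'n) set) = ennreal (sqrt (2 + 2 / real n)))
     \<and> (\<forall>n::nat. n \<ge> 5 \<and> CARD('n) = n + 2 \<and> CARD('m::finite) = n + 1 \<longrightarrow>
          distortion (simplex_boundary :: (real^'n) set) < distortion (sphere (0 :: real^'m) 1))"
proof (intro conjI allI impI)
  show "\<exists>H>0. \<forall>h\<ge>H. distortion (cone_surface h) < ennreal (pi / 2)"
    by (rule exI[of _ 20]) (use distortion_cone_surface_less in auto)
next
  fix n :: nat assume n: "n \<ge> 1 \<and> CARD('n) = n + 2"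
  then show "distortion (simplex_boundary :: (real^'n) set) = ennreal (sqrt (2 + 2 / real n))"
    by (intro distortion_simplex_boundary) auto
next
  fix n :: nat assume n: "n \<ge> 5 \<and> CARD('n) = n + 2 \<and> CARD('m) = n + 1"
  have "2 / real n \<le> 2 / 5" using n by (intro divide_left_mono) auto
  moreover have "(155 / 100)\<^sup>2 < (pi / 2)\<^sup>2"
    using pi_approx by (intro power_strict_mono) auto
  ultimately have "2 + 2 / real n < (pi / 2)\<^sup>2" by (simp add: power2_eq_square)
  then have "sqrt (2 + 2 / real n) < pi / 2"
    by (intro real_less_lsqrt) auto
  then have "ennreal (sqrt (2 + 2 / real n)) < ennreal (pi / 2)"
    by (simp add: ennreal_less_iff)
  moreover have "distortion (simplex_boundary :: (real^'n) set) = ennreal (sqrt (2 + 2 / real n))"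
    using n by (intro distortion_simplex_boundary) auto
  ultimately show "distortion (simplex_boundary :: (real^'n) set) < distortion (sphere (0 :: real^'m) 1)"
    using distortion_sphere_ge[where 'm = 'm] by (metis less_le_trans)
qed

end
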